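(* Let $0\le k\le n$ and let $\mathfrak{I}:\mathbb{X}_n\times\mathbb{X}_n\to\mathbb{R}$ be a complete $n$-symmetric $\mathrm{PDI}_k$ kernel that is zero on the extended diagonal $\Delta^n_{k-1}$. Then there exists a constant $C_{n,k}>0$ (depending only on $n$ and $k$) for which $$|\mathfrak{I}(x_{\vec 1},x_{\vec 2})|\le C_{n,k}\sum_{|F|=k}\mathfrak{I}(x_{\vec 1_F+\vec 3_{F^c}},x_{\vec 2_F+\vec 3_{F^c}}),\qquad x_{\vec 1},x_{\vec 2},x_{\vec 3}\in\mathbb{X}_n,$$ where the sum is over all $F\subset\{1,\dots,n\}$ with $|F|=k$. In particular, the only complete $n$-symmetric $\mathrm{PDI}_k$ kernel that is zero on the extended diagonal $\Delta^n_k$ is the zero kernel.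
   Context: $X_1,\dots,X_n$ are nonempty sets, $\mathbb{X}_n=\prod_{i=1}^nX_i$. For points $x_{\vec a}=(x_1^a,\dots,x_n^a)$ and a multi-index $\alpha$, $x_\alpha=(x_1^{\alpha_1},\dots,x_n^{\alpha_n})$; for $F\subset\{1,\dots,n\}$, $x_{\vec a_F+\vec b_{F^c}}$ is the point with coordinates $x_i^a$ for $i\in F$ and $x_i^b$ for $i\notin F$. $\mathcal{M}(\mathbb{X}_n)$ is the space of finitely supported real signed measures on $\mathbb{X}_n$; $\mathcal{M}_k(\mathbb{X}_n)$ is the subspace of those $\mu$ with $\mu(\prod_iA_i)=0$ whenever $A_i\subset X_i$ and $|\{i:A_i=X_i\}|\ge n-k+1$. A kernel is $n$-symmetric if $\mathfrak{I}(x_{\vec 1},x_{\vec 2})=\mathfrak{I}(x_\alpha,x_{\vec 3-\alpha})$ for all $\alpha\in\{1,2\}^n$, $x_{\vec 1},x_{\vec 2}\in\mathbb{X}_n$ (here $\vec 3-\alpha=(3-\alpha_i)_i$). It is $\mathrm{PDI}_k$ if it is $n$-symmetric and $\iint(-1)^k\mathfrak{I}(u,v)\,d\mu(u)d\mu(v)\ge0$ for all $\mu\in\mathcal{M}_k(\mathbb{X}_n)$. It is complete $n$-symmetric if it is $n$-symmetric and $\mathfrak{I}(x_{\vec 1_F+\vec 3_{F^c}},x_{\vec 2_F+\vec 3_{F^c}})=\mathfrak{I}(x_{\vec 1_F+\vec 4_{F^c}},x_{\vec 2_F+\vec 4_{F^c}})$ for all $F\subset\{1,\dots,n\}$ and all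 $x_{\vec 1},x_{\vec 2},x_{\vec 3},x_{\vec 4}\in\mathbb{X}_n$. The extended diagonal $\Delta^n_{k-1}$ is the set of pairs $(x_{\vec 1},x_{\vec 2})\in\mathbb{X}_n\times\mathbb{X}_n$ with $|\{i:x_i^1=x_i^2\}|\ge n-k+1$; accordingly $\Delta^n_k$ is the set of pairs with $|\{i:x_i^1=x_i^2\}|\ge n-k$. *)

theory Defs
  imports Complex_Main "HOL-Library.FuncSet"
begin

text \<open>
  The sets \<open>X 1, \<dots>, X n\<close> are subsets of a common type. This is no restriction, since any
  family of sets embeds into its disjoint union. Points are extensional functions on \<open>{1..n}\<close>.
\<close>

definition prod_space :: "nat \<Rightarrow> (nat \<Rightarrow> 'a set) \<Rightarrow> (nat \<Rightarrow> 'a) set" where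
  "prod_space n X = PiE {1..n} X"

text \<open>
  For a sequence of points \<open>x 1, x 2, \<dots>\<close> (the points \<open>x\<^sub>a\<close> with constant multi-index \<open>a\<close>) and a
  multi-index \<open>\<alpha>\<close>, this is the point \<open>x\<^sub>\<alpha>\<close>, whose \<open>i\<close>-th coordinate is that of \<open>x (\<alpha> i)\<close>.
\<close>

definition mix :: "nat \<Rightarrow> (nat \<Rightarrow> nat \<Rightarrow> 'a) \<Rightarrow> (nat \<Rightarrow> nat) \<Rightarrow> nat \<Rightarrow> 'a" where
  "mix n x \<alpha> = (\<lambda>i\<in>{1..n}. x (\<alpha> i) i)"

text \<open>The multi-index that is \<open>a\<close> on \<open>F\<close> and \<open>b\<close> off \<open>F\<close>.\<close>

definition split_index :: "nat set \<Rightarrow> nat \<Rightarrow> nat \<Rightarrow> nat \<Rightarrow> nat" where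
  "split_index F a b = (\<lambda>i. if i \<in> F then a else b)"

text \<open>A finitely supported signed measure is represented by its point masses.\<close>

definition supp :: "('b \<Rightarrow> real) \<Rightarrow> 'b set" where
  "supp \<mu> = {u. \<mu> u \<noteq> 0}"

definition fin_measures :: "'b set \<Rightarrow> ('b \<Rightarrow> real) set" where
  "fin_measures S = {\<mu>. finite (supp \<mu>) \<and> supp \<mu> \<subseteq> S}"

definition mass :: "('b \<Rightarrow> real) \<Rightarrow> 'b set \<Rightarrow> real" where
  "mass \<mu> A = (\<Sum>u\<in>supp \<mu> \<inter> A. \<mu> u)"

definition double_integral :: "('b \<Rightarrow> 'b \<Rightarrow> real) \<Rightarrow> ('b \<Rightarrow> real) \<Rightarrow> real" where
  "double_integral f \<mu> = (\<Sum>u\<in>supp \<mu>. \<Sum>v\<in>supp \<mu>. f u v * \<mu> u * \<mu> v)"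

text \<open>
  The condition \<open>card \<dots> \<ge> n - k + 1\<close> is written additively to avoid truncated subtraction.
  For \<open>k = 0\<close> it is never met, and all finitely supported measures are allowed.
\<close>

definition M_k :: "nat \<Rightarrow> nat \<Rightarrow> (nat \<Rightarrow> 'a set) \<Rightarrow> ((nat \<Rightarrow> 'a) \<Rightarrow> real) set" where
  "M_k n k X = {\<mu> \<in> fin_measures (prod_space n X).
     \<forall>A. (\<forall>i\<in>{1..n}. A i \<subseteq> X i) \<and> card {i\<in>{1..n}. A i = X i} + k \<ge> n + 1
       \<longrightarrow> mass \<mu> (PiE {1..n} A) = 0}"

type_synonym 'a kernel = "(nat \<Rightarrow> 'a) \<Rightarrow> (nat \<Rightarrow> 'a) \<Rightarrow> real"

definition n_symmetric :: "nat \<Rightarrow> (nat \<Rightarrow> 'a set) \<Rightarrow> 'a kernel \<Rightarrow> bool" where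
  "n_symmetric n X I \<longleftrightarrow>
     (\<forall>x \<alpha>. x 1 \<in> prod_space n X \<and> x 2 \<in> prod_space n X \<and> (\<forall>i\<in>{1..n}. \<alpha> i \<in> {1, 2}) \<longrightarrow>
        I (x 1) (x 2) = I (mix n x \<alpha>) (mix n x (\<lambda>i. 3 - \<alpha> i)))"

definition PDI :: "nat \<Rightarrow> nat \<Rightarrow> (nat \<Rightarrow> 'a set) \<Rightarrow> 'a kernel \<Rightarrow> bool" where
  "PDI n k X I \<longleftrightarrow> n_symmetric n X I \<and>
     (\<forall>\<mu>\<in>M_k n k X. double_integral (\<lambda>u v. (-1) ^ k * I u v) \<mu> \<ge> 0)"

definition complete_n_symmetric :: "nat \<Rightarrow> (nat \<Rightarrow> 'a set) \<Rightarrow> 'a kernel \<Rightarrow> bool" where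
  "complete_n_symmetric n X I \<longleftrightarrow> n_symmetric n X I \<and>
     (\<forall>F x. F \<subseteq> {1..n} \<and> (\<forall>a\<in>{1..4}. x a \<in> prod_space n X) \<longrightarrow>
        I (mix n x (split_index F 1 3)) (mix n x (split_index F 2 3)) =
        I (mix n x (split_index F 1 4)) (mix n x (split_index F 2 4)))"

text \<open>The index is an integer since the extended diagonal of index \<open>-1\<close> (which is empty) occurs.\<close>

definition ext_diagonal :: "nat \<Rightarrow> (nat \<Rightarrow> 'a set) \<Rightarrow> int \<Rightarrow> ((nat \<Rightarrow> 'a) \<times> (nat \<Rightarrow> 'a)) set" where
  "ext_diagonal n X j = {(u, v). u \<in> prod_space n X \<and> v \<in> prod_space n X \<and>
     int (card {i\<in>{1..n}. u i = v i}) \<ge> int n - j}"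

definition zero_on :: "((nat \<Rightarrow> 'a) \<times> (nat \<Rightarrow> 'a)) set \<Rightarrow> 'a kernel \<Rightarrow> bool" where
  "zero_on D I \<longleftrightarrow> (\<forall>(u, v)\<in>D. I u v = 0)"

definition nonempty_family :: "nat \<Rightarrow> (nat \<Rightarrow> 'a set) \<Rightarrow> bool" where
  "nonempty_family n X \<longleftrightarrow> (\<forall>i\<in>{1..n}. X i \<noteq> {})"

definition kernel_bound :: "nat \<Rightarrow> nat \<Rightarrow> (nat \<Rightarrow> 'a set) \<Rightarrow> 'a kernel \<Rightarrow> real \<Rightarrow> bool" where
  "kernel_bound n k X I C \<longleftrightarrow>
     (\<forall>x. (\<forall>a\<in>{1..3}. x a \<in> prod_space n X) \<longrightarrow>
        \<bar>I (x 1) (x 2)\<bar> \<le> C * (\<Sum>F | F \<subseteq> {1..n} \<and> card F = k.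
          I (mix n x (split_index F 1 3)) (mix n x (split_index F 2 3))))"

text \<open>
  \<open>C\<close> bounds all admissible kernels on all products of \<open>n\<close> nonempty subsets of the type \<open>'a\<close>.
\<close>

definition bound_constant :: "'a itself \<Rightarrow> nat \<Rightarrow> nat \<Rightarrow> real \<Rightarrow> bool" where
  "bound_constant _ n k C \<longleftrightarrow>
     (\<forall>(X :: nat \<Rightarrow> 'a set) I. nonempty_family n X \<and> complete_n_symmetric n X I \<and> PDI n k X I \<and>
        zero_on (ext_diagonal n X (int k - 1)) I \<longrightarrow> kernel_bound n k X I C)"

end

theory Submission imports Defs begin

text \<open>
  Switching the coordinates of \<open>x 1\<close> in a set \<open>U\<close> to those of \<open>x 2\<close> maps the cube of subsets of
  \<open>{1..n}\<close> into the product space, and complete \<open>n\<close>-symmetry makes the pulled back kernel a function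
  \<open>f\<close> of the symmetric difference alone. The characters \<open>(-1) ^ card (U \<inter> T)\<close> with \<open>card T \<ge> k\<close>
  are admissible test measures, so the Fourier coefficients of \<open>f\<close> at these \<open>T\<close> have the sign
  \<open>(-1) ^ k\<close>. Summing them over all \<open>T \<supseteq> R\<close> gives, up to a power of 2, the alternating sum of \<open>f\<close>
  over the subsets of \<open>R\<close>; by positivity this decreases in \<open>R\<close>, so for \<open>card R \<ge> k\<close> it is
  controlled by its value \<open>f F\<close> at some \<open>F \<subseteq> R\<close> with \<open>card F = k\<close>. Moebius inversion recovers
  \<open>f {1..n}\<close>. A constant valid at type \<open>nat\<close> transfers to other types because the points \<open>x 1\<close>,
  \<open>x 2\<close>, \<open>x 3\<close> are images of constant multi-indices under \<open>mix n x\<close>, and the hypotheses pull back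
  along this map.
\<close>

section \<open>Signed sums over subsets\<close>

lemma sum_eq_0_by_sign_reversing_involution:
  fixes g :: "'b \<Rightarrow> real"
  assumes "\<And>a. a \<in> A \<Longrightarrow> \<tau> a \<in> A" and "\<And>a. a \<in> A \<Longrightarrow> \<tau> (\<tau> a) = a"
    and "\<And>a. a \<in> A \<Longrightarrow> g (\<tau> a) = - g a"
  shows "sum g A = 0"
proof -
  have "sum g A = (\<Sum>a\<in>A. - g a)"
    by (rule sum.reindex_bij_witness[where i = \<tau> and j = \<tau>]) (use assms in auto)
  then show ?thesis
    by (simp add: sum_negf)
qed

text \<open>Elements of \<open>U \<inter> V \<inter> T\<close> are counted in both exponents on the
  right and contribute an even number. So \<open>T\<close> defines a character of the group of
  finite sets under symmetric difference.\<close>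

lemma minus_one_power_card_sym_diff:
  assumes "finite U" "finite V"
  shows "(-1::real) ^ card (sym_diff U V \<inter> T) = (-1) ^ card (U \<inter> T) * (-1) ^ card (V \<inter> T)"
proof -
  have U: "card (U \<inter> T) = card ((U - V) \<inter> T) + card (U \<inter> V \<inter> T)"
    by (subst card_Un_disjoint[symmetric]) (use assms in \<open>auto intro: arg_cong[where f = card]\<close>)
  have V: "card (V \<inter> T) = card ((V - U) \<inter> T) + card (U \<inter> V \<inter> T)"
    by (subst card_Un_disjoint[symmetric]) (use assms in \<open>auto intro: arg_cong[where f = card]\<close>)
  have "card (sym_diff U V \<inter> T) = card ((U - V) \<inter> T) + card ((V - U) \<inter> T)"
    by (subst card_Un_disjoint[symmetric]) (use assms in \<open>auto intro: arg_cong[where f = card]\<close>)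
  then show ?thesis
    unfolding U V by (simp add: power_add algebra_simps flip: power_mult_distrib)
qed

lemma minus_one_power_card_flip:
  assumes "finite U" "i \<in> T"
  shows "(-1::real) ^ card (sym_diff U {i} \<inter> T) = - ((-1) ^ card (U \<inter> T))"
  using minus_one_power_card_sym_diff[OF assms(1), of "{i}" T] assms(2) by simp

lemma card_subsets_above:
  assumes "finite N" "R \<subseteq> N"
  shows "card {T. R \<subseteq> T \<and> T \<subseteq> N} = 2 ^ (card N - card R)"
proof -
  have "bij_betw (\<lambda>A. A \<union> R) (Pow (N - R)) {T. R \<subseteq> T \<and> T \<subseteq> N}"
    by (rule bij_betw_byWitness[where f' = "\<lambda>T. T - R"]) (use assms in auto)
  then have "card {T. R \<subseteq> T \<and> T \<subseteq> N} = card (Pow (N - R))"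
    by (simp add: bij_betw_same_card)
  then show ?thesis
    using assms by (simp add: card_Pow card_Diff_subset finite_subset)
qed

text \<open>If \<open>S\<close> has an element outside \<open>R\<close>, toggling it in
  \<open>T\<close> changes the sign of the term, and the sum cancels. Otherwise
  \<open>S \<inter> T = S\<close> for every \<open>T\<close> above \<open>R\<close>, and all terms
  coincide.\<close>

lemma sum_characters_above:
  assumes "finite N" "R \<subseteq> N" "S \<subseteq> N"
  shows "(\<Sum>T | R \<subseteq> T \<and> T \<subseteq> N. (-1::real) ^ card (S \<inter> T)) =
    (if S \<subseteq> R then 2 ^ (card N - card R) * (-1) ^ card S else 0)"
proof (cases "S \<subseteq> R")
  case True
  have "(\<Sum>T | R \<subseteq> T \<and> T \<subseteq> N. (-1::real) ^ card (S \<inter> T)) =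
      (\<Sum>T | R \<subseteq> T \<and> T \<subseteq> N. (-1) ^ card S)"
    by (rule sum.cong) (use True in \<open>auto intro!: arg_cong[where f = card] simp: Int_absorb2\<close>)
  then show ?thesis
    using True card_subsets_above[OF assms(1,2)] by simp
next
  case False
  then obtain i where i: "i \<in> S" "i \<notin> R"
    by auto
  have "(\<Sum>T | R \<subseteq> T \<and> T \<subseteq> N. (-1::real) ^ card (S \<inter> T)) = 0"
  proof (rule sum_eq_0_by_sign_reversing_involution[where \<tau> = "\<lambda>T. sym_diff T {i}"])
    fix T assume "T \<in> {T. R \<subseteq> T \<and> T \<subseteq> N}"
    then have "finite T"
      using assms(1) finite_subset by auto
    then show "(-1::real) ^ card (S \<inter> sym_diff T {i}) = - ((-1) ^ card (S \<inter> T))"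
      using minus_one_power_card_flip[of T i S] i by (simp add: Int_commute)
  qed (use i assms in auto)
  then show ?thesis
    using False by simp
qed

text \<open>After the sums are exchanged, the inner sum runs over all sets between \<open>S\<close>
  and \<open>N\<close>. It is a case of \<open>sum_characters_above\<close> with \<open>N\<close> as
  the set tested, and vanishes unless \<open>S = N\<close>.\<close>

lemma moebius_inversion_at_top:
  fixes f :: "'b set \<Rightarrow> real"
  assumes "finite N"
  shows "f N = (\<Sum>R\<in>Pow N. (-1) ^ card R * (\<Sum>S\<in>Pow R. (-1) ^ card S * f S))"
proof -
  have fin: "finite R" if "R \<in> Pow N" for R
    using that assms finite_subset by auto
  have "(\<Sum>R\<in>Pow N. (-1) ^ card R * (\<Sum>S\<in>Pow R. (-1) ^ card S * f S)) =
      (\<Sum>R\<in>Pow N. \<Sum>S\<in>{S. S \<in> Pow N \<and> S \<subseteq> R}. (-1) ^ card R * ((-1) ^ card S * f S))"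
    by (intro sum.cong) (auto simp: sum_distrib_left intro!: sum.cong)
  also have "\<dots> = (\<Sum>S\<in>Pow N. \<Sum>R\<in>{R. R \<in> Pow N \<and> S \<subseteq> R}. (-1) ^ card R * ((-1) ^ card S * f S))"
    using assms by (intro sum.swap_restrict) auto
  also have "\<dots> = (\<Sum>S\<in>Pow N. (-1) ^ card S * f S * (\<Sum>T | S \<subseteq> T \<and> T \<subseteq> N. (-1) ^ card (N \<inter> T)))"
    by (intro sum.cong refl)
       (auto simp: sum_distrib_left Int_absorb1 mult_ac intro!: sum.cong)
  also have "\<dots> = (\<Sum>S\<in>Pow N. if S = N then f S else 0)"
    using assms by (intro sum.cong refl) (auto simp: sum_characters_above mult_ac simp flip: power_mult_distrib)
  also have "\<dots> = f N"
    using assms by simp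
  finally show ?thesis ..
qed

section \<open>From the signs of Fourier coefficients to the bound\<close>

text \<open>The factor \<open>4 ^ card N\<close> is a product of two powers of 2: each alternating
  sum is at most \<open>2 ^ card N\<close> times the sum over \<open>F\<close>, and Moebius
  inversion adds up \<open>2 ^ card N\<close> of them.\<close>

lemma bound_from_fourier_sign:
  fixes f :: "'b set \<Rightarrow> real"
  assumes N: "finite N"
    and zero: "\<And>S. S \<subseteq> N \<Longrightarrow> card S < k \<Longrightarrow> f S = 0"
    and sign: "\<And>T. T \<subseteq> N \<Longrightarrow> k \<le> card T \<Longrightarrow> 0 \<le> (-1) ^ k * (\<Sum>S\<in>Pow N. (-1) ^ card (S \<inter> T) * f S)"
  shows "\<bar>f N\<bar> \<le> 4 ^ card N * (\<Sum>F | F \<subseteq> N \<and> card F = k. f F)"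
proof -
  define G where "G T = (-1) ^ k * (\<Sum>S\<in>Pow N. (-1) ^ card (S \<inter> T) * f S)" for T
  define H where "H R = (\<Sum>S\<in>Pow R. (-1) ^ card S * f S)" for R
  let ?s = "\<Sum>F | F \<subseteq> N \<and> card F = k. f F"
  have fin: "finite R" if "R \<subseteq> N" for R
    using that N finite_subset by auto
  \<comment> \<open>Exchanging the sums leaves, for each \<open>S\<close>, the sum of characters
    over all \<open>T\<close> above \<open>R\<close>; it keeps exactly the subsets \<open>S\<close>
    of \<open>R\<close>.\<close>
  have G_sum: "(\<Sum>T | R \<subseteq> T \<and> T \<subseteq> N. G T) = 2 ^ (card N - card R) * ((-1) ^ k * H R)" if "R \<subseteq> N" for R
  proof -
    have "(\<Sum>T | R \<subseteq> T \<and> T \<subseteq> N. G T) =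
        (-1) ^ k * (\<Sum>S\<in>Pow N. (\<Sum>T | R \<subseteq> T \<and> T \<subseteq> N. (-1) ^ card (S \<inter> T)) * f S)"
      unfolding G_def sum_distrib_left sum_distrib_right by (subst sum.swap) simp
    also have "\<dots> = (-1) ^ k * (\<Sum>S\<in>Pow N. if S \<subseteq> R then 2 ^ (card N - card R) * ((-1) ^ card S * f S) else 0)"
      using N that by (intro arg_cong[where f = "(*) _"] sum.cong refl) (auto simp: sum_characters_above)
    also have "\<dots> = (-1) ^ k * (\<Sum>S\<in>Pow R. 2 ^ (card N - card R) * ((-1) ^ card S * f S))"
      using N that by (intro arg_cong[where f = "(*) _"] sum.mono_neutral_cong_right) auto
    finally show ?thesis
      by (simp add: H_def sum_distrib_left mult_ac)
  qed
  have H_small: "H R = 0" if "R \<subseteq> N" "card R < k" for R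
  proof -
    have "f S = 0" if "S \<subseteq> R" for S
    proof (rule zero)
      show "card S < k"
        using card_mono[OF fin[OF \<open>R \<subseteq> N\<close>] that] \<open>card R < k\<close> by simp
    qed (use that \<open>R \<subseteq> N\<close> in auto)
    then show ?thesis
      by (simp add: H_def)
  qed
  have H_k: "(-1) ^ k * H F = f F" if "F \<subseteq> N" "card F = k" for F
  proof -
    have "f S = 0" if "S \<subseteq> F" "S \<noteq> F" for S
    proof (rule zero)
      show "card S < k"
        using psubset_card_mono[OF fin[OF \<open>F \<subseteq> N\<close>], of S] that \<open>card F = k\<close> by auto
    qed (use that \<open>F \<subseteq> N\<close> in auto)
    then have "H F = (\<Sum>S\<in>Pow F. if S = F then (-1) ^ k * f F else 0)"
      unfolding H_def by (intro sum.cong) (use that in auto)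
    also have "\<dots> = (-1) ^ k * f F"
      using fin[OF that(1)] by simp
    finally show ?thesis
      by (simp flip: power_mult_distrib mult.assoc)
  qed
  have G_nonneg: "0 \<le> G T" if "R \<subseteq> T" "T \<subseteq> N" "k \<le> card R" for R T
    unfolding G_def using card_mono[OF fin[OF that(2)] that(1)] that by (intro sign) auto
  have f_nonneg: "0 \<le> f F" if "F \<subseteq> N" "card F = k" for F
  proof -
    have "0 \<le> (\<Sum>T | F \<subseteq> T \<and> T \<subseteq> N. G T)"
      using that by (intro sum_nonneg) (auto intro: G_nonneg)
    then show ?thesis
      using G_sum[OF that(1)] H_k[OF that] mult_le_cancel_left_pos[of "2 ^ (card N - card F)" 0 "f F"]
      by simp
  qed
  have s_nonneg: "0 \<le> ?s"
    by (intro sum_nonneg) (auto intro: f_nonneg)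
  have H_bound: "\<bar>H R\<bar> \<le> 2 ^ card N * ?s" if "R \<subseteq> N" for R
  proof (cases "card R < k")
    case True
    then show ?thesis
      using H_small[OF that] s_nonneg by simp
  next
    case False
    then obtain F where F: "F \<subseteq> R" "card F = k"
      by (meson obtain_subset_with_card_n not_less)
    \<comment> \<open>The power of 2 is inserted to match the right-hand side of
      \<open>G_sum\<close>.\<close>
    have "\<bar>H R\<bar> \<le> 2 ^ (card N - card R) * \<bar>H R\<bar>"
      by (simp add: mult_le_cancel_right1)
    also have "\<dots> = \<bar>\<Sum>T | R \<subseteq> T \<and> T \<subseteq> N. G T\<bar>"
      unfolding G_sum[OF that] by (simp add: abs_mult power_abs)
    also have "\<dots> = (\<Sum>T | R \<subseteq> T \<and> T \<subseteq> N. G T)"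
      using False by (intro abs_of_nonneg sum_nonneg) (auto intro: G_nonneg)
    \<comment> \<open>Every set above \<open>R\<close> is also above \<open>F\<close>, and the
      additional sets have at least \<open>k\<close> elements, so their \<open>G T\<close> are
      nonnegative.\<close>
    also have "\<dots> \<le> (\<Sum>T | F \<subseteq> T \<and> T \<subseteq> N. G T)"
      using N F by (intro sum_mono2) (auto intro: G_nonneg)
    also have "\<dots> = 2 ^ (card N - card F) * f F"
      using G_sum[of F] H_k[of F] F that by auto
    also have "\<dots> \<le> 2 ^ card N * f F"
      using F that by (intro mult_right_mono f_nonneg) auto
    also have "\<dots> \<le> 2 ^ card N * ?s"
      using N F that by (intro mult_left_mono member_le_sum) (auto intro: f_nonneg)
    finally show ?thesis .
  qed
  have "\<bar>f N\<bar> = \<bar>\<Sum>R\<in>Pow N. (-1) ^ card R * H R\<bar>"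
    unfolding H_def using moebius_inversion_at_top[OF N, of f] by simp
  also have "\<dots> \<le> (\<Sum>R\<in>Pow N. \<bar>H R\<bar>)"
    by (rule order_trans[OF sum_abs]) (simp add: abs_mult power_abs)
  also have "\<dots> \<le> (\<Sum>R\<in>Pow N. 2 ^ card N * ?s)"
    by (intro sum_mono H_bound) auto
  also have "\<dots> = 4 ^ card N * ?s"
    using N by (simp add: card_Pow flip: power_mult_distrib mult.assoc)
  finally show ?thesis .
qed

section \<open>Images of finitely supported signed measures\<close>

text \<open>Masses are added over fibres because \<open>p\<close> need not be injective: where
  \<open>x 1\<close> and \<open>x 2\<close> share a coordinate, different sets of switched
  coordinates give the same point. Masses may then cancel, so the support can be smaller than the
  image of \<open>p\<close>.\<close>

definition pushforward :: "'c set \<Rightarrow> ('c \<Rightarrow> real) \<Rightarrow> ('c \<Rightarrow> 'b) \<Rightarrow> 'b \<Rightarrow> real" where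
  "pushforward \<Omega> w p q = (\<Sum>\<omega> | \<omega> \<in> \<Omega> \<and> p \<omega> = q. w \<omega>)"

lemma supp_pushforward_subset: "supp (pushforward \<Omega> w p) \<subseteq> p ` \<Omega>"
proof
  fix q assume "q \<in> supp (pushforward \<Omega> w p)"
  then have "{\<omega>. \<omega> \<in> \<Omega> \<and> p \<omega> = q} \<noteq> {}"
    unfolding supp_def pushforward_def by (metis (mono_tags) mem_Collect_eq sum.empty)
  then show "q \<in> p ` \<Omega>"
    by auto
qed

text \<open>Change of variables: image points outside the support contribute 0, and the remaining
  sum groups \<open>\<Omega>\<close> by the fibres of \<open>p\<close>.\<close>

lemma sum_pushforward:
  assumes "finite \<Omega>"
  shows "(\<Sum>q\<in>supp (pushforward \<Omega> w p). g q * pushforward \<Omega> w p q) = (\<Sum>\<omega>\<in>\<Omega>. g (p \<omega>) * w \<omega>)"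
proof -
  have "(\<Sum>q\<in>supp (pushforward \<Omega> w p). g q * pushforward \<Omega> w p q) =
      (\<Sum>q\<in>p ` \<Omega>. g q * pushforward \<Omega> w p q)"
    using assms supp_pushforward_subset[of \<Omega> w p]
    by (intro sum.mono_neutral_left) (auto simp: supp_def)
  also have "\<dots> = (\<Sum>q\<in>p ` \<Omega>. \<Sum>\<omega> | \<omega> \<in> \<Omega> \<and> p \<omega> = q. g (p \<omega>) * w \<omega>)"
    unfolding pushforward_def sum_distrib_left by (intro sum.cong) auto
  also have "\<dots> = (\<Sum>\<omega>\<in>\<Omega>. g (p \<omega>) * w \<omega>)"
    using sum.image_gen[OF assms, of "\<lambda>\<omega>. g (p \<omega>) * w \<omega>" p] by simp
  finally show ?thesis .
qed

text \<open>Change of variables for the indicator function of \<open>A\<close>.\<close>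

lemma mass_pushforward:
  assumes "finite \<Omega>"
  shows "mass (pushforward \<Omega> w p) A = (\<Sum>\<omega> | \<omega> \<in> \<Omega> \<and> p \<omega> \<in> A. w \<omega>)"
proof -
  have fin: "finite (supp (pushforward \<Omega> w p))"
    by (rule finite_subset[OF supp_pushforward_subset]) (use assms in simp)
  have "mass (pushforward \<Omega> w p) A =
      (\<Sum>q\<in>supp (pushforward \<Omega> w p). (if q \<in> A then 1 else 0) * pushforward \<Omega> w p q)"
    unfolding mass_def using fin by (intro sum.mono_neutral_cong_left) auto
  also have "\<dots> = (\<Sum>\<omega>\<in>\<Omega>. (if p \<omega> \<in> A then 1 else 0) * w \<omega>)"
    by (rule sum_pushforward[OF assms])
  also have "\<dots> = (\<Sum>\<omega> | \<omega> \<in> \<Omega> \<and> p \<omega> \<in> A. w \<omega>)"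
    using assms by (intro sum.mono_neutral_cong_right) auto
  finally show ?thesis .
qed

lemma double_integral_pushforward:
  assumes "finite \<Omega>"
  shows "double_integral f (pushforward \<Omega> w p) =
    (\<Sum>\<omega>\<in>\<Omega>. \<Sum>\<omega>'\<in>\<Omega>. f (p \<omega>) (p \<omega>') * w \<omega> * w \<omega>')"
proof -
  let ?\<mu> = "pushforward \<Omega> w p"
  have "double_integral f ?\<mu> = (\<Sum>u\<in>supp ?\<mu>. (\<Sum>v\<in>supp ?\<mu>. f u v * ?\<mu> v) * ?\<mu> u)"
    unfolding double_integral_def sum_distrib_right by (simp add: mult_ac)
  also have "\<dots> = (\<Sum>\<omega>\<in>\<Omega>. (\<Sum>\<omega>'\<in>\<Omega>. f (p \<omega>) (p \<omega>') * w \<omega>') * w \<omega>)"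
    by (simp add: sum_pushforward[OF assms])
  finally show ?thesis
    by (simp add: sum_distrib_right sum_distrib_left mult_ac)
qed

section \<open>Mixed points and the symmetries of the kernel\<close>

lemma mix_in_prod_space:
  assumes "\<And>i. i \<in> {1..n} \<Longrightarrow> x (\<alpha> i) \<in> prod_space n X"
  shows "mix n x \<alpha> \<in> prod_space n X"
  unfolding mix_def prod_space_def
proof (rule restrict_PiE_iff[THEN iffD2], rule ballI)
  fix i assume i: "i \<in> {1..n}"
  show "x (\<alpha> i) i \<in> X i"
    using assms[OF i] i unfolding prod_space_def by (rule PiE_mem)
qed

lemma mix_split_index_in_prod_space:
  assumes "x a \<in> prod_space n X" "x b \<in> prod_space n X"
  shows "mix n x (split_index F a b) \<in> prod_space n X"
  by (rule mix_in_prod_space) (use assms in \<open>auto simp: split_index_def\<close>)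

lemma mix_cong:
  assumes "\<And>i. i \<in> {1..n} \<Longrightarrow> x (\<alpha> i) i = y (\<beta> i) i"
  shows "mix n x \<alpha> = mix n y \<beta>"
  unfolding mix_def by (rule restrict_ext) (use assms in auto)

lemma mix_eq_point:
  assumes "u \<in> prod_space n X" "\<And>i. i \<in> {1..n} \<Longrightarrow> x (\<alpha> i) i = u i"
  shows "mix n x \<alpha> = u"
proof
  fix i
  show "mix n x \<alpha> i = u i"
    using assms PiE_arb[of u "{1..n}" X i] by (auto simp: mix_def prod_space_def restrict_def)
qed

lemma n_symmetricD:
  assumes "n_symmetric n X I" "x 1 \<in> prod_space n X" "x 2 \<in> prod_space n X"
    and "\<And>i. i \<in> {1..n} \<Longrightarrow> \<alpha> i \<in> {1, 2}"
  shows "I (x 1) (x 2) = I (mix n x \<alpha>) (mix n x (\<lambda>i. 3 - \<alpha> i))"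
  using assms unfolding n_symmetric_def by blast

lemma complete_n_symmetricD:
  assumes "complete_n_symmetric n X I" "F \<subseteq> {1..n}" "\<And>a. a \<in> {1..4} \<Longrightarrow> x a \<in> prod_space n X"
  shows "I (mix n x (split_index F 1 3)) (mix n x (split_index F 2 3)) =
    I (mix n x (split_index F 1 4)) (mix n x (split_index F 2 4))"
  using assms unfolding complete_n_symmetric_def by blast

text \<open>With \<open>x 1\<close> as the fourth point, the mixture of the first and fourth points
  collapses to \<open>x 1\<close>. This frees the left-hand side from its dependence on
  \<open>x 3\<close>.\<close>

lemma complete_n_symmetric_background:
  assumes I: "complete_n_symmetric n X I" and F: "F \<subseteq> {1..n}"
    and x: "x 1 \<in> prod_space n X" "x 2 \<in> prod_space n X" "x 3 \<in> prod_space n X"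
  shows "I (mix n x (split_index F 1 3)) (mix n x (split_index F 2 3)) =
    I (x 1) (mix n x (split_index F 2 1))"
proof -
  define z where "z = x(4 := x 1)"
  have four: "a \<in> {1..4} \<longleftrightarrow> a = 1 \<or> a = 2 \<or> a = 3 \<or> a = 4" for a :: nat
    by auto
  have "I (mix n z (split_index F 1 3)) (mix n z (split_index F 2 3)) =
      I (mix n z (split_index F 1 4)) (mix n z (split_index F 2 4))"
    by (rule complete_n_symmetricD[OF I F]) (use x in \<open>unfold four, auto simp: z_def\<close>)
  moreover have "mix n z (split_index F 1 3) = mix n x (split_index F 1 3)"
    "mix n z (split_index F 2 3) = mix n x (split_index F 2 3)"
    "mix n z (split_index F 2 4) = mix n x (split_index F 2 1)"
    by (auto intro!: mix_cong simp: z_def split_index_def)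
  moreover have "mix n z (split_index F 1 4) = x 1"
    by (rule mix_eq_point[OF x(1)]) (auto simp: z_def split_index_def)
  ultimately show ?thesis
    by simp
qed

text \<open>Symmetry over \<open>U\<close> replaces the points switched on \<open>U\<close> and
  \<open>V\<close> by those switched on \<open>U \<inter> V\<close> and \<open>U \<union> V\<close>.
  On the symmetric difference these have the coordinates of \<open>x 1\<close> and
  \<open>x 2\<close> respectively, elsewhere they agree, and complete symmetry lets the common
  coordinates be changed to those of \<open>x 1\<close>.\<close>

lemma kernel_sym_diff:
  assumes I: "complete_n_symmetric n X I" and UV: "U \<subseteq> {1..n}" "V \<subseteq> {1..n}"
    and x: "x 1 \<in> prod_space n X" "x 2 \<in> prod_space n X"
  shows "I (mix n x (split_index U 2 1)) (mix n x (split_index V 2 1)) =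
    I (x 1) (mix n x (split_index (sym_diff U V) 2 1))"
proof -
  define y where "y = (\<lambda>a::nat. mix n x (split_index (if a = 1 then U else V) 2 1))"
  \<comment> \<open>Off the symmetric difference \<open>y 1\<close> and \<open>y 2\<close> agree, so
    \<open>y 1\<close> can serve as the common background.\<close>
  define z where "z = x(3 := y 1)"
  have y: "y a \<in> prod_space n X" for a
    unfolding y_def by (intro mix_split_index_in_prod_space x)
  have "I (y 1) (y 2) = I (mix n y (split_index U 2 1)) (mix n y (\<lambda>i. 3 - split_index U 2 1 i))"
    by (rule n_symmetricD) (use I y in \<open>auto simp: complete_n_symmetric_def split_index_def\<close>)
  also have "mix n y (split_index U 2 1) = mix n z (split_index (sym_diff U V) 1 3)"
    by (rule mix_cong) (auto simp: z_def y_def split_index_def mix_def)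
  also have "mix n y (\<lambda>i. 3 - split_index U 2 1 i) = mix n z (split_index (sym_diff U V) 2 3)"
    by (rule mix_cong) (auto simp: z_def y_def split_index_def mix_def)
  also have "I (mix n z (split_index (sym_diff U V) 1 3)) (mix n z (split_index (sym_diff U V) 2 3)) =
      I (z 1) (mix n z (split_index (sym_diff U V) 2 1))"
    by (rule complete_n_symmetric_background[OF I]) (use UV x y in \<open>auto simp: z_def\<close>)
  also have "mix n z (split_index (sym_diff U V) 2 1) = mix n x (split_index (sym_diff U V) 2 1)"
    by (rule mix_cong) (auto simp: z_def split_index_def)
  finally show ?thesis
    by (simp add: y_def z_def)
qed

section \<open>Characters as test measures\<close>

text \<open>By counting, a box with at least \<open>n - k + 1\<close> full sides has a full side in
  some direction \<open>i\<close> of \<open>T\<close>. Switching coordinate \<open>i\<close> does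
  not leave the box but reverses the sign of the character, so the mass cancels.\<close>

lemma character_pushforward_in_M_k:
  assumes T: "T \<subseteq> {1..n}" "k \<le> card T"
    and x: "x 1 \<in> prod_space n X" "x 2 \<in> prod_space n X"
  shows "pushforward (Pow {1..n}) (\<lambda>U. (-1) ^ card (U \<inter> T)) (\<lambda>U. mix n x (split_index U 2 1)) \<in> M_k n k X"
    (is "pushforward ?P ?w ?p \<in> _")
proof -
  have p: "?p U \<in> prod_space n X" for U
    by (intro mix_split_index_in_prod_space x)
  have "pushforward ?P ?w ?p \<in> fin_measures (prod_space n X)"
    using supp_pushforward_subset[of ?P ?w ?p] p unfolding fin_measures_def
    by (auto intro: finite_subset)
  moreover have "mass (pushforward ?P ?w ?p) (PiE {1..n} A) = 0"
    if A: "card {i\<in>{1..n}. A i = X i} + k \<ge> n + 1" for A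
  proof -
    have "\<exists>i\<in>T. A i = X i"
    proof (rule ccontr)
      assume "\<not> ?thesis"
      then have disj: "T \<inter> {i\<in>{1..n}. A i = X i} = {}"
        by auto
      have "card T + card {i\<in>{1..n}. A i = X i} = card (T \<union> {i\<in>{1..n}. A i = X i})"
        using disj T finite_subset[of T "{1..n}"] by (intro card_Un_disjoint[symmetric]) auto
      also have "\<dots> \<le> card {1..n}"
        using T by (intro card_mono) auto
      finally show False
        using A T(2) by simp
    qed
    then obtain i where i: "i \<in> T" "A i = X i"
      by auto
    have inA: "?p U \<in> PiE {1..n} A \<longleftrightarrow> (\<forall>j\<in>{1..n}. x (split_index U 2 1 j) j \<in> A j)" for U
      unfolding mix_def by (simp add: Pi_iff)
    have "x a i \<in> X i" if "a \<in> {1, 2}" for a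
      using that x i T unfolding prod_space_def by (auto dest: PiE_mem)
    then have flip: "?p (sym_diff U {i}) \<in> PiE {1..n} A" if "?p U \<in> PiE {1..n} A" for U
      using that i unfolding inA by (auto simp: split_index_def)
    have "(\<Sum>U | U \<in> ?P \<and> ?p U \<in> PiE {1..n} A. ?w U) = 0"
    proof (rule sum_eq_0_by_sign_reversing_involution[where \<tau> = "\<lambda>U. sym_diff U {i}"])
      fix U assume U: "U \<in> {U. U \<in> ?P \<and> ?p U \<in> PiE {1..n} A}"
      then show "sym_diff U {i} \<in> {U. U \<in> ?P \<and> ?p U \<in> PiE {1..n} A}"
        using i T flip[of U] by auto
      have "finite U"
        using U finite_subset by auto
      then show "?w (sym_diff U {i}) = - ?w U"
        using i by (intro minus_one_power_card_flip)
    qed auto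
    then show ?thesis
      by (subst mass_pushforward) auto
  qed
  ultimately show ?thesis
    unfolding M_k_def by blast
qed

text \<open>Kernel and product of characters both depend on the symmetric difference of
  \<open>U\<close> and \<open>V\<close> only. All rows of the quadratic form thus have the same sum,
  and the form is \<open>2 ^ n\<close> times the signed Fourier coefficient.\<close>

lemma fourier_coefficient_sign:
  assumes I: "complete_n_symmetric n X I" "PDI n k X I"
    and T: "T \<subseteq> {1..n}" "k \<le> card T"
    and x: "x 1 \<in> prod_space n X" "x 2 \<in> prod_space n X"
  shows "0 \<le> (-1) ^ k * (\<Sum>S\<in>Pow {1..n}. (-1) ^ card (S \<inter> T) * I (x 1) (mix n x (split_index S 2 1)))"
proof -
  let ?P = "Pow {1..n}"
  let ?w = "\<lambda>U::nat set. (-1::real) ^ card (U \<inter> T)"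
  let ?p = "\<lambda>U. mix n x (split_index U 2 1)"
  let ?f = "\<lambda>S. I (x 1) (?p S)"
  have row: "(\<Sum>V\<in>?P. ((-1) ^ k * I (?p U) (?p V)) * ?w U * ?w V) = (-1) ^ k * (\<Sum>S\<in>?P. ?w S * ?f S)"
    if U: "U \<in> ?P" for U
  proof -
    have fin: "finite W" if "W \<in> ?P" for W
      using that finite_subset by auto
    have "(\<Sum>V\<in>?P. ((-1) ^ k * I (?p U) (?p V)) * ?w U * ?w V) =
        (\<Sum>V\<in>?P. (-1) ^ k * (?w (sym_diff U V) * ?f (sym_diff U V)))"
    proof (intro sum.cong refl)
      fix V assume V: "V \<in> ?P"
      show "((-1) ^ k * I (?p U) (?p V)) * ?w U * ?w V = (-1) ^ k * (?w (sym_diff U V) * ?f (sym_diff U V))"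
        using kernel_sym_diff[OF I(1) _ _ x, of U V] U V
          minus_one_power_card_sym_diff[OF fin[OF U] fin[OF V], of T]
        by simp
    qed
    \<comment> \<open>For fixed \<open>U\<close>, symmetric difference with \<open>U\<close> is an
      involution of the power set.\<close>
    also have "\<dots> = (\<Sum>S\<in>?P. (-1) ^ k * (?w S * ?f S))"
      by (rule sum.reindex_bij_witness[where i = "sym_diff U" and j = "sym_diff U"])
         (use U in \<open>auto simp: Un_Diff Diff_Diff_Int\<close>)
    finally show ?thesis
      by (simp add: sum_distrib_left)
  qed
  have "0 \<le> double_integral (\<lambda>u v. (-1) ^ k * I u v) (pushforward ?P ?w ?p)"
    using I(2) character_pushforward_in_M_k[OF T x] unfolding PDI_def by blast
  also have "\<dots> = (\<Sum>U\<in>?P. \<Sum>V\<in>?P. ((-1) ^ k * I (?p U) (?p V)) * ?w U * ?w V)"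
    by (rule double_integral_pushforward) simp
  also have "\<dots> = 2 ^ n * ((-1) ^ k * (\<Sum>S\<in>?P. ?w S * ?f S))"
    using row by (simp add: card_Pow)
  finally show ?thesis
    using mult_le_cancel_left_pos[of "2 ^ n" 0 "(-1) ^ k * (\<Sum>S\<in>?P. ?w S * ?f S)"] by simp
qed

section \<open>The extended diagonal and the bound on a fixed product\<close>

lemma card_agree_ge:
  assumes "F \<subseteq> {1..n}" "\<And>i. i \<in> {1..n} \<Longrightarrow> i \<notin> F \<Longrightarrow> u i = v i"
  shows "int (card {i\<in>{1..n}. u i = v i}) \<ge> int n - int (card F)"
proof -
  have "n = card ({1..n} - F) + card F"
    using assms(1) card_mono[of "{1..n}" F] by (simp add: card_Diff_subset finite_subset)
  moreover have "card ({1..n} - F) \<le> card {i\<in>{1..n}. u i = v i}"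
    using assms by (intro card_mono) auto
  ultimately show ?thesis
    by linarith
qed

lemma zero_on_ext_diagonalD:
  assumes "zero_on (ext_diagonal n X j) I" "u \<in> prod_space n X" "v \<in> prod_space n X"
    and "F \<subseteq> {1..n}" "int (card F) \<le> j" "\<And>i. i \<in> {1..n} \<Longrightarrow> i \<notin> F \<Longrightarrow> u i = v i"
  shows "I u v = 0"
proof -
  have "int (card {i\<in>{1..n}. u i = v i}) \<ge> int n - j"
    using card_agree_ge[OF assms(4), of u v] assms(5,6) by fastforce
  then show ?thesis
    using assms(1-3) unfolding zero_on_def ext_diagonal_def by blast
qed

text \<open>The function \<open>?f\<close> on subsets has the value \<open>I (x 1) (x 2)\<close> at
  \<open>{1..n}\<close>, and \<open>complete_n_symmetric_background\<close> rewrites each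
  \<open>?f F\<close> as the summand with background \<open>x 3\<close>.\<close>

lemma kernel_bound_4_power:
  fixes X :: "nat \<Rightarrow> 'a set"
  assumes I: "complete_n_symmetric n X I" "PDI n k X I" "zero_on (ext_diagonal n X (int k - 1)) I"
  shows "kernel_bound n k X I (4 ^ n)"
  unfolding kernel_bound_def
proof (intro allI impI)
  fix x :: "nat \<Rightarrow> nat \<Rightarrow> 'a" assume "\<forall>a\<in>{1..3}. x a \<in> prod_space n X"
  then have x: "x 1 \<in> prod_space n X" "x 2 \<in> prod_space n X" "x 3 \<in> prod_space n X"
    by auto
  let ?f = "\<lambda>S. I (x 1) (mix n x (split_index S 2 1))"
  have "\<bar>?f {1..n}\<bar> \<le> 4 ^ card {1..n} * (\<Sum>F | F \<subseteq> {1..n} \<and> card F = k. ?f F)"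
  proof (rule bound_from_fourier_sign)
    fix S assume S: "S \<subseteq> {1..n}" "card S < k"
    show "?f S = 0"
      by (rule zero_on_ext_diagonalD[OF I(3) x(1) mix_split_index_in_prod_space[of x, OF x(2,1)] S(1)])
         (use S in \<open>auto simp: mix_def split_index_def\<close>)
  qed (use fourier_coefficient_sign[OF I(1,2) _ _ x(1,2)] in auto)
  moreover have "mix n x (split_index {1..n} 2 1) = x 2"
    by (rule mix_eq_point[OF x(2)]) (auto simp: split_index_def)
  ultimately show "\<bar>I (x 1) (x 2)\<bar> \<le> 4 ^ n * (\<Sum>F | F \<subseteq> {1..n} \<and> card F = k.
      I (mix n x (split_index F 1 3)) (mix n x (split_index F 2 3)))"
    using complete_n_symmetric_background[OF I(1) _ x] by simp
qed

section \<open>Pullback to multi-indices and change of type\<close>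

text \<open>Multi-indices with values in a set \<open>A\<close> are themselves points of a product
  space over \<open>nat\<close>, with all factors equal to \<open>A\<close>.\<close>

definition pullback :: "nat \<Rightarrow> (nat \<Rightarrow> nat \<Rightarrow> 'a) \<Rightarrow> 'a kernel \<Rightarrow> nat kernel" where
  "pullback n x I \<alpha> \<beta> = I (mix n x \<alpha>) (mix n x \<beta>)"

text \<open>This associativity turns the symmetry conditions for a pullback into instances of those
  for the original kernel.\<close>

lemma mix_mix: "mix n x (mix n \<beta> \<alpha>) = mix n (\<lambda>a. mix n x (\<beta> a)) \<alpha>"
  by (auto simp: mix_def)

lemma pullback_mix_mem:
  assumes "\<And>a. a \<in> A \<Longrightarrow> x a \<in> prod_space n X" "\<alpha> \<in> prod_space n (\<lambda>_. A)"
  shows "mix n x \<alpha> \<in> prod_space n X"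
proof (rule mix_in_prod_space)
  fix i assume i: "i \<in> {1..n}"
  show "x (\<alpha> i) \<in> prod_space n X"
    by (rule assms(1), rule PiE_mem[OF assms(2)[unfolded prod_space_def] i])
qed

lemma n_symmetric_pullback:
  assumes "n_symmetric n X I" and x: "\<And>a. a \<in> A \<Longrightarrow> x a \<in> prod_space n X"
  shows "n_symmetric n (\<lambda>_. A) (pullback n x I)"
  unfolding n_symmetric_def
proof (intro allI impI, elim conjE)
  fix y :: "nat \<Rightarrow> nat \<Rightarrow> nat" and \<alpha>
  assume y: "y 1 \<in> prod_space n (\<lambda>_. A)" "y 2 \<in> prod_space n (\<lambda>_. A)"
    and \<alpha>: "\<forall>i\<in>{1..n}. \<alpha> i \<in> {1, 2::nat}"
  show "pullback n x I (y 1) (y 2) = pullback n x I (mix n y \<alpha>) (mix n y (\<lambda>i. 3 - \<alpha> i))"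
    unfolding pullback_def mix_mix
    by (rule n_symmetricD[OF assms(1), where x = "\<lambda>a. mix n x (y a)"])
       (use y \<alpha> in \<open>auto intro: pullback_mix_mem[OF x]\<close>)
qed

lemma complete_n_symmetric_pullback:
  assumes "complete_n_symmetric n X I" and x: "\<And>a. a \<in> A \<Longrightarrow> x a \<in> prod_space n X"
  shows "complete_n_symmetric n (\<lambda>_. A) (pullback n x I)"
  unfolding complete_n_symmetric_def
proof (intro conjI allI impI)
  show "n_symmetric n (\<lambda>_. A) (pullback n x I)"
    using assms n_symmetric_pullback unfolding complete_n_symmetric_def by blast
next
  fix F and y :: "nat \<Rightarrow> nat \<Rightarrow> nat"
  assume "F \<subseteq> {1..n} \<and> (\<forall>a\<in>{1..4}. y a \<in> prod_space n (\<lambda>_. A))"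
  then show "pullback n x I (mix n y (split_index F 1 3)) (mix n y (split_index F 2 3)) =
      pullback n x I (mix n y (split_index F 1 4)) (mix n y (split_index F 2 4))"
    unfolding pullback_def mix_mix
    by (intro complete_n_symmetricD[OF assms(1)]) (auto intro: pullback_mix_mem[OF x])
qed

text \<open>The preimage of a box under \<open>mix n x\<close> is a box, and full sides pull back to
  full sides because all coordinates of the points \<open>x a\<close> lie in the factors of
  \<open>X\<close>.\<close>

lemma pushforward_in_M_k:
  assumes \<mu>: "\<mu> \<in> M_k n k (\<lambda>_. A)" and x: "\<And>a. a \<in> A \<Longrightarrow> x a \<in> prod_space n X"
  shows "pushforward (supp \<mu>) \<mu> (mix n x) \<in> M_k n k X"
proof -
  have supp: "finite (supp \<mu>)" "supp \<mu> \<subseteq> prod_space n (\<lambda>_. A)"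
    using \<mu> unfolding M_k_def fin_measures_def by auto
  have "pushforward (supp \<mu>) \<mu> (mix n x) \<in> fin_measures (prod_space n X)"
  proof -
    have "mix n x ` supp \<mu> \<subseteq> prod_space n X"
      using supp(2) by (auto intro: pullback_mix_mem[of A x, OF x])
    then show ?thesis
      using supp_pushforward_subset[of "supp \<mu>" \<mu> "mix n x"] supp(1)
      unfolding fin_measures_def by (auto intro: finite_subset)
  qed
  moreover have "mass (pushforward (supp \<mu>) \<mu> (mix n x)) (PiE {1..n} B) = 0"
    if B: "card {i\<in>{1..n}. B i = X i} + k \<ge> n + 1" for B
  proof -
    \<comment> \<open>The sides of the preimage box.\<close>
    define B' where "B' i = {a\<in>A. x a i \<in> B i}" for i
    have "x a i \<in> X i" if "a \<in> A" "i \<in> {1..n}" for a i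
      using x[OF that(1)] that(2) unfolding prod_space_def by (rule PiE_mem)
    then have "card {i\<in>{1..n}. B i = X i} \<le> card {i\<in>{1..n}. B' i = A}"
      by (intro card_mono) (auto simp: B'_def)
    then have "card {i\<in>{1..n}. B' i = A} + k \<ge> n + 1"
      using B by simp
    moreover have "\<forall>i\<in>{1..n}. B' i \<subseteq> A"
      by (auto simp: B'_def)
    ultimately have "mass \<mu> (PiE {1..n} B') = 0"
      using \<mu> unfolding M_k_def by blast
    moreover have "{\<alpha>. \<alpha> \<in> supp \<mu> \<and> mix n x \<alpha> \<in> PiE {1..n} B} = supp \<mu> \<inter> PiE {1..n} B'"
      using supp(2) unfolding mix_def prod_space_def B'_def by (auto simp: PiE_iff)
    ultimately show ?thesis
      unfolding mass_pushforward[OF supp(1)] by (simp add: mass_def)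
  qed
  ultimately show ?thesis
    unfolding M_k_def by blast
qed

lemma PDI_pullback:
  assumes I: "PDI n k X I" and x: "\<And>a. a \<in> A \<Longrightarrow> x a \<in> prod_space n X"
  shows "PDI n k (\<lambda>_. A) (pullback n x I)"
  unfolding PDI_def
proof (intro conjI ballI)
  show "n_symmetric n (\<lambda>_. A) (pullback n x I)"
    using assms n_symmetric_pullback unfolding PDI_def by blast
next
  fix \<mu> assume \<mu>: "\<mu> \<in> M_k n k (\<lambda>_. A)"
  then have "finite (supp \<mu>)"
    unfolding M_k_def fin_measures_def by auto
  then have "double_integral (\<lambda>u v. (-1) ^ k * pullback n x I u v) \<mu> =
      double_integral (\<lambda>u v. (-1) ^ k * I u v) (pushforward (supp \<mu>) \<mu> (mix n x))"
    by (simp add: double_integral_pushforward) (simp add: double_integral_def pullback_def)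
  then show "0 \<le> double_integral (\<lambda>u v. (-1) ^ k * pullback n x I u v) \<mu>"
    using I pushforward_in_M_k[OF \<mu> x] unfolding PDI_def by simp
qed

text \<open>Mixed points agree wherever their multi-indices do, so passing to points can only
  enlarge the set of agreement.\<close>

lemma zero_on_ext_diagonal_pullback:
  assumes I: "zero_on (ext_diagonal n X j) I" and x: "\<And>a. a \<in> A \<Longrightarrow> x a \<in> prod_space n X"
  shows "zero_on (ext_diagonal n (\<lambda>_. A) j) (pullback n x I)"
  unfolding zero_on_def
proof (intro ballI, clarify)
  fix \<alpha> \<beta> assume *: "(\<alpha>, \<beta>) \<in> ext_diagonal n (\<lambda>_. A) j"
  have "card {i\<in>{1..n}. \<alpha> i = \<beta> i} \<le> card {i\<in>{1..n}. mix n x \<alpha> i = mix n x \<beta> i}"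
    by (intro card_mono) (auto simp: mix_def)
  then have "(mix n x \<alpha>, mix n x \<beta>) \<in> ext_diagonal n X j"
    using * pullback_mix_mem[OF x] unfolding ext_diagonal_def by auto
  then show "pullback n x I \<alpha> \<beta> = 0"
    using I unfolding zero_on_def pullback_def by blast
qed

text \<open>Each instance of the inequality involves three points and their mixtures only, so it can
  be read on the multi-indices with values in \<open>{1..3}\<close>.\<close>

lemma bound_constant_transfer:
  assumes "bound_constant TYPE(nat) n k C"
  shows "bound_constant TYPE('a) n k C"
  unfolding bound_constant_def kernel_bound_def
proof (intro allI impI, elim conjE)
  fix X :: "nat \<Rightarrow> 'a set" and I and x :: "nat \<Rightarrow> nat \<Rightarrow> 'a"
  assume I: "complete_n_symmetric n X I" "PDI n k X I" "zero_on (ext_diagonal n X (int k - 1)) I"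
    and "\<forall>a\<in>{1..3}. x a \<in> prod_space n X"
  then have x: "x a \<in> prod_space n X" if "a \<in> {1..3}" for a
    using that by blast
  let ?Y = "\<lambda>_::nat. {1..3::nat}"
  let ?c = "\<lambda>a::nat. \<lambda>i\<in>{1..n}. a"
  have bound: "kernel_bound n k ?Y (pullback n x I) C"
    using assms complete_n_symmetric_pullback[of n X I "{1..3}" x, OF I(1) x]
      PDI_pullback[of n k X I "{1..3}" x, OF I(2) x]
      zero_on_ext_diagonal_pullback[of n X _ I "{1..3}" x, OF I(3) x]
    unfolding bound_constant_def nonempty_family_def by auto
  have "?c a \<in> prod_space n ?Y" if "a \<in> {1..3}" for a
    using that by (auto simp: prod_space_def)
  then have "\<bar>pullback n x I (?c 1) (?c 2)\<bar> \<le> C * (\<Sum>F | F \<subseteq> {1..n} \<and> card F = k.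
      pullback n x I (mix n ?c (split_index F 1 3)) (mix n ?c (split_index F 2 3)))"
    by (intro bound[unfolded kernel_bound_def, rule_format])
  moreover have "mix n x (?c a) = x a" if "a \<in> {1..3}" for a
    by (rule mix_eq_point[OF x[OF that]]) auto
  moreover have "mix n x (mix n ?c \<alpha>) = mix n x \<alpha>" for \<alpha>
    by (auto simp: mix_def)
  ultimately show "\<bar>I (x 1) (x 2)\<bar> \<le> C * (\<Sum>F | F \<subseteq> {1..n} \<and> card F = k.
      I (mix n x (split_index F 1 3)) (mix n x (split_index F 2 3)))"
    by (simp add: pullback_def)
qed

section \<open>Kernels vanishing on the larger diagonal\<close>

text \<open>Both arguments of each summand in the bound agree off a set \<open>F\<close> of size
  \<open>k\<close>, so the right-hand side is 0.\<close>

lemma kernel_eq_0_of_zero_on_ext_diagonal: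
  assumes I: "complete_n_symmetric n X I" "PDI n k X I" "zero_on (ext_diagonal n X (int k)) I"
    and uv: "u \<in> prod_space n X" "v \<in> prod_space n X"
  shows "I u v = 0"
proof -
  \<comment> \<open>The third point may be any point of the product; \<open>u\<close> is at
    hand.\<close>
  define x where "x = (\<lambda>a::nat. if a = 2 then v else u)"
  have x: "x a \<in> prod_space n X" for a
    using uv by (simp add: x_def)
  have "zero_on (ext_diagonal n X (int k - 1)) I"
    using I(3) unfolding zero_on_def ext_diagonal_def by auto
  then have "\<bar>I (x 1) (x 2)\<bar> \<le> 4 ^ n * (\<Sum>F | F \<subseteq> {1..n} \<and> card F = k.
      I (mix n x (split_index F 1 3)) (mix n x (split_index F 2 3)))"
    using kernel_bound_4_power[OF I(1,2)] x unfolding kernel_bound_def by blast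
  also have "\<dots> = 4 ^ n * (\<Sum>F | F \<subseteq> {1..n} \<and> card F = k. 0)"
  proof (intro arg_cong[where f = "(*) _"] sum.cong refl)
    fix F assume F: "F \<in> {F. F \<subseteq> {1..n} \<and> card F = k}"
    show "I (mix n x (split_index F 1 3)) (mix n x (split_index F 2 3)) = 0"
      by (rule zero_on_ext_diagonalD[OF I(3) mix_split_index_in_prod_space mix_split_index_in_prod_space,
            where F = F])
         (use F x in \<open>auto simp: mix_def split_index_def\<close>)
  qed
  finally show ?thesis
    by (simp add: x_def)
qed

text \<open>This is the converse direction of the final equivalence. Values of \<open>I\<close>
  outside the product space are arbitrary, so each condition has to be seen to evaluate
  \<open>I\<close> inside it only.\<close>

lemma zero_kernel_admissible:
  fixes X :: "nat \<Rightarrow> 'a set"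
  assumes zero: "\<And>u v. u \<in> prod_space n X \<Longrightarrow> v \<in> prod_space n X \<Longrightarrow> I u v = 0"
  shows "complete_n_symmetric n X I" "PDI n k X I" "zero_on (ext_diagonal n X j) I"
proof -
  have sym: "n_symmetric n X I"
    unfolding n_symmetric_def
  proof (intro allI impI, elim conjE)
    fix x :: "nat \<Rightarrow> nat \<Rightarrow> 'a" and \<alpha>
    assume x: "x 1 \<in> prod_space n X" "x 2 \<in> prod_space n X" and \<alpha>: "\<forall>i\<in>{1..n}. \<alpha> i \<in> {1, 2::nat}"
    have "x (\<alpha> i) \<in> prod_space n X \<and> x (3 - \<alpha> i) \<in> prod_space n X" if "i \<in> {1..n}" for i
      using bspec[OF \<alpha> that] x by auto
    then have "mix n x \<alpha> \<in> prod_space n X" "mix n x (\<lambda>i. 3 - \<alpha> i) \<in> prod_space n X"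
      by (auto intro!: mix_in_prod_space)
    then show "I (x 1) (x 2) = I (mix n x \<alpha>) (mix n x (\<lambda>i. 3 - \<alpha> i))"
      using zero x by simp
  qed
  show "complete_n_symmetric n X I"
    unfolding complete_n_symmetric_def using sym by (auto simp: zero mix_split_index_in_prod_space)
  have "double_integral (\<lambda>u v. (-1) ^ k * I u v) \<mu> = 0" if "\<mu> \<in> M_k n k X" for \<mu>
    unfolding double_integral_def
    by (intro sum.neutral ballI) (use that zero in \<open>auto simp: M_k_def fin_measures_def\<close>)
  then show "PDI n k X I"
    unfolding PDI_def using sym by simp
  show "zero_on (ext_diagonal n X j) I"
    using zero unfolding zero_on_def ext_diagonal_def by auto
qed

(* HOL cannot quantify over types under the existential quantifier for C. The second conjunct
   makes C depend on n and k only: a constant obtained from the first conjunct at type nat is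
   valid at every type. *)
theorem theorem36:
  fixes n k :: nat
  assumes "k \<le> n"
  shows "(\<exists>C>0. \<forall>(X :: nat \<Rightarrow> 'a set) I.
            nonempty_family n X \<and> complete_n_symmetric n X I \<and> PDI n k X I \<and>
            zero_on (ext_diagonal n X (int k - 1)) I \<longrightarrow>
            (\<forall>x. (\<forall>a\<in>{1..3}. x a \<in> prod_space n X) \<longrightarrow>
               \<bar>I (x 1) (x 2)\<bar> \<le> C * (\<Sum>F | F \<subseteq> {1..n} \<and> card F = k.
                 I (mix n x (split_index F 1 3)) (mix n x (split_index F 2 3)))))
       \<and> (\<forall>C>0. bound_constant TYPE(nat) n k C \<longrightarrow> bound_constant TYPE('a) n k C)
       \<and> (\<forall>(X :: nat \<Rightarrow> 'a set) I. nonempty_family n X \<longrightarrow>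
            (complete_n_symmetric n X I \<and> PDI n k X I \<and>
               zero_on (ext_diagonal n X (int k)) I
             \<longleftrightarrow> (\<forall>u\<in>prod_space n X. \<forall>v\<in>prod_space n X. I u v = 0)))"
proof (intro conjI)
  show "\<exists>C>0. \<forall>(X :: nat \<Rightarrow> 'a set) I.
      nonempty_family n X \<and> complete_n_symmetric n X I \<and> PDI n k X I \<and>
      zero_on (ext_diagonal n X (int k - 1)) I \<longrightarrow>
      (\<forall>x. (\<forall>a\<in>{1..3}. x a \<in> prod_space n X) \<longrightarrow>
         \<bar>I (x 1) (x 2)\<bar> \<le> C * (\<Sum>F | F \<subseteq> {1..n} \<and> card F = k.
           I (mix n x (split_index F 1 3)) (mix n x (split_index F 2 3))))"
    using kernel_bound_4_power unfolding kernel_bound_def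
    by (intro exI[of _ "4 ^ n"] conjI) (simp, blast)
  show "\<forall>C>0. bound_constant TYPE(nat) n k C \<longrightarrow> bound_constant TYPE('a) n k C"
    using bound_constant_transfer by blast
  show "\<forall>(X :: nat \<Rightarrow> 'a set) I. nonempty_family n X \<longrightarrow>
      (complete_n_symmetric n X I \<and> PDI n k X I \<and> zero_on (ext_diagonal n X (int k)) I
       \<longleftrightarrow> (\<forall>u\<in>prod_space n X. \<forall>v\<in>prod_space n X. I u v = 0))"
    using kernel_eq_0_of_zero_on_ext_diagonal zero_kernel_admissible by metis
qed

end
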